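(* Let $d\geq 1$, let $X=\mathbb{R}^d$ with the Euclidean distance and Lebesgue measure, let $\omega(t)=t$, $\kappa>1$, $\Phi>0$, and let $1<p<\infty$. Then the power $\gamma^{1/2}=\beta^{d/2}$ in the weighted estimates for the intrinsic square function $G_{\omega,\beta}$ is optimal for power weights, already for the weak type estimate: for every $\theta<1/2$ there exists $\alpha$ with $-d<\alpha<(p-1)d$ such that, for the $A_p$ weight $w(x)=|x|^\alpha$, $$\sup_{\beta\geq 1}\ \beta^{-d\theta}\,\|G_{\omega,\beta}\|_{L^p(w)\to L^{p,\infty}(w)}=\infty .$$
   Context: $B(x,r)$ is the Euclidean ball, $|B|$ its Lebesgue measure. In this setting $\gamma:=\sup_{x,t}|B(x,\beta t)|/|B(x,t)|=\beta^d$. For $x\in\mathbb{R}^d$, $k\in\mathbb{Z}$ let $C_\omega(x,k)$ be the class of functions $\phi:\mathbb{R}^d\to\mathbb{R}$ with $\operatorname{supp}\phi\subset B(x,\kappa^k)$, $\int\phi=0$, $\sup_y|\phi(y)|\leq |B(x,\kappa^k)|^{-1}\Phi$, and $|\phi(y)-\phi(y')|\leq|B(x,\kappa^k)|^{-1}\,\omega(|y-y'|/\kappa^k)$ for all $y,y'$. For $f\in L^1_{\mathrm{loc}}(\mathbb{R}^d)$ put $A_\omega f(x,k) := \sup_{\phi\in C_\omega(x,k)}|\int f\phi|$, and define the intrinsic square function with aperture $\beta$ by $$G_{\omega,\beta}f(x) := \Big(\sum_{k\in\mathbb{Z}} \frac{1}{|B(x,\beta\kappa^k)|}\int_{B(x,\beta\kappa^k)}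 (A_\omega f(y,k))^2\,dy\Big)^{1/2}.$$ $\|G_{\omega,\beta}\|_{L^p(w)\to L^{p,\infty}(w)}$ is the smallest $N\in[0,\infty]$ such that $\sup_{\lambda>0}\lambda\, w(\{G_{\omega,\beta}f>\lambda\})^{1/p}\leq N\big(\int|f|^p w\big)^{1/p}$ for all $f\in L^p(w)$, where $w(E)=\int_E w$. The estimates whose optimality is asserted are the one weight bounds $\|G_{\omega,\beta}\|_{L^p(w)\to L^p(w)}\leq C\gamma^{1/2}$ and $\|G_{\omega,\beta}\|_{L^p(w)\to L^{p,\infty}(w)}\leq C\gamma^{1/2}$ with $C$ depending on $w$, $p$, $d$, $\kappa$, $\omega$ but not on $\beta$. *)

theory Defs
  imports "HOL-Analysis.Analysis"
begin

(* Real powers on [0, \<infinity>], meant for s > 0 only: \<infinity>^s = \<infinity> and 0^s = 0. *)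
definition ennpowr :: "ennreal \<Rightarrow> real \<Rightarrow> ennreal" (infixr \<open>ennpowr\<close> 80)
  where "a ennpowr s = (if a = \<infinity> then \<infinity> else ennreal (enn2real a powr s))"

definition nn_average :: "'a::euclidean_space set \<Rightarrow> ('a \<Rightarrow> ennreal) \<Rightarrow> ennreal"
  where "nn_average B g = (\<integral>\<^sup>+x\<in>B. g x \<partial>lborel) / emeasure lborel B"

(* The class C_\<omega>(x, k) with scale parameter \<kappa> and size constant \<Phi>.  The support is the closed
   support, and B(x, r) is the open ball throughout. *)
definition test_class ::
    "real \<Rightarrow> real \<Rightarrow> (real \<Rightarrow> real) \<Rightarrow> 'a::euclidean_space \<Rightarrow> int \<Rightarrow> ('a \<Rightarrow> real) set"
  where "test_class \<kappa> \<Phi> \<omega> x k = {\<phi>.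
    closure {y. \<phi> y \<noteq> 0} \<subseteq> ball x (\<kappa> powi k) \<and>
    has_bochner_integral lborel \<phi> 0 \<and>
    (\<forall>y. \<bar>\<phi> y\<bar> \<le> \<Phi> / measure lborel (ball x (\<kappa> powi k))) \<and>
    (\<forall>y y'. \<bar>\<phi> y - \<phi> y'\<bar> \<le> \<omega> (dist y y' / \<kappa> powi k) / measure lborel (ball x (\<kappa> powi k)))}"

(* Meant for locally integrable f, so that the integrals exist. *)
definition maximal_coeff ::
    "real \<Rightarrow> real \<Rightarrow> (real \<Rightarrow> real) \<Rightarrow> ('a::euclidean_space \<Rightarrow> real) \<Rightarrow> 'a \<Rightarrow> int \<Rightarrow> ennreal"
  where "maximal_coeff \<kappa> \<Phi> \<omega> f x k =
    (SUP \<phi>\<in>test_class \<kappa> \<Phi> \<omega> x k. ennreal \<bar>\<integral>y. f y * \<phi> y \<partial>lborel\<bar>)"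

definition intrinsic_square ::
    "real \<Rightarrow> real \<Rightarrow> (real \<Rightarrow> real) \<Rightarrow> real \<Rightarrow> ('a::euclidean_space \<Rightarrow> real) \<Rightarrow> 'a \<Rightarrow> ennreal"
  where "intrinsic_square \<kappa> \<Phi> \<omega> \<beta> f x =
    (\<Sum>\<^sub>\<infinity>k\<in>UNIV. nn_average (ball x (\<beta> * \<kappa> powi k)) (\<lambda>y. (maximal_coeff \<kappa> \<Phi> \<omega> f y k)\<^sup>2))
      ennpowr (1/2)"

definition weight_measure :: "('a::euclidean_space \<Rightarrow> real) \<Rightarrow> 'a set \<Rightarrow> ennreal"
  where "weight_measure w E = (\<integral>\<^sup>+x\<in>E. ennreal (w x) \<partial>lborel)"

definition Lp_norm :: "real \<Rightarrow> ('a::euclidean_space \<Rightarrow> real) \<Rightarrow> ('a \<Rightarrow> real) \<Rightarrow> ennreal"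
  where "Lp_norm p w f = (\<integral>\<^sup>+x. ennreal (\<bar>f x\<bar> powr p * w x) \<partial>lborel) ennpowr (1/p)"

(* Borel functions suffice: every almost-everywhere class has a Borel representative. *)
definition Lp_space :: "real \<Rightarrow> ('a::euclidean_space \<Rightarrow> real) \<Rightarrow> ('a \<Rightarrow> real) set"
  where "Lp_space p w = {f \<in> borel_measurable borel. Lp_norm p w f < \<infinity>}"

definition weak_Lp_norm :: "real \<Rightarrow> ('a::euclidean_space \<Rightarrow> real) \<Rightarrow> ('a \<Rightarrow> ennreal) \<Rightarrow> ennreal"
  where "weak_Lp_norm p w g =
    (SUP t\<in>{0<..}. ennreal t * weight_measure w {x. g x > ennreal t} ennpowr (1/p))"

(* The smallest constant N in [0, \<infinity>]. *)
definition weak_type_norm ::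
    "real \<Rightarrow> ('a::euclidean_space \<Rightarrow> real) \<Rightarrow> (('a \<Rightarrow> real) \<Rightarrow> 'a \<Rightarrow> ennreal) \<Rightarrow> ennreal"
  where "weak_type_norm p w T =
    Inf {N. \<forall>f\<in>Lp_space p w. weak_Lp_norm p w (T f) \<le> N * Lp_norm p w f}"

(* Local integrability of w is implied: the second average is never 0. *)
definition Ap_weight :: "real \<Rightarrow> ('a::euclidean_space \<Rightarrow> real) \<Rightarrow> bool"
  where "Ap_weight p w \<longleftrightarrow>
    w \<in> borel_measurable borel \<and> (AE x in lborel. w x > 0) \<and>
    (SUP (x, r)\<in>UNIV \<times> {0<..}.
       nn_average (ball x r) (\<lambda>y. ennreal (w y)) *
       nn_average (ball x r) (\<lambda>y. ennreal (w y powr (- 1 / (p - 1)))) ennpowr (p - 1)) < \<infinity>"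

end

theory Submission
  imports Defs
begin

text \<open>
Large apertures are expensive because the weight may grow almost as fast as the Ap condition
permits.  Fix a function \<open>f\<close> supported in the unit ball whose coefficients at scale \<open>k = 0\<close> are
bounded below on \<open>ball 0 (1/2)\<close>; the indicator of a small ball will do
(lemma \<open>maximal_coeff_indicator_ge\<close>).  Write \<open>d\<close> for the dimension.  If \<open>norm x < \<beta>/2\<close>, the
averaging ball of radius \<open>\<beta>\<close> around \<open>x\<close> contains \<open>ball 0 (1/2)\<close>, so the single term \<open>k = 0\<close>
forces the square function to be at least a constant times \<open>\<beta> powr (- d/2)\<close>
(\<open>intrinsic_square_ge\<close>).  The set of these \<open>x\<close> has mass comparable to \<open>\<beta> powr (d + \<alpha>)\<close> for the
weight \<open>norm x powr \<alpha>\<close>, while the norm of \<open>f\<close> is independent of \<open>\<beta>\<close>.  Hence the weak type norm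
is at least a constant times \<open>\<beta> powr ((d + \<alpha>) / p - d/2)\<close> (\<open>weak_type_norm_ge\<close>).

As \<open>\<alpha>\<close> increases to \<open>(p - 1) d\<close> this exponent increases to \<open>d/2\<close>, so it exceeds \<open>d \<theta>\<close> for
suitable \<open>\<alpha>\<close>.  Such \<open>\<alpha>\<close> may be taken nonnegative, which keeps the weight bounded on balls and
leaves only the dual power to be integrated in the proof of the Ap condition
(\<open>Ap_weight_norm_powr\<close>).
\<close>

section \<open>Powers and averages with values in \<open>[0, \<infinity>]\<close>\<close>

lemma ennpowr_ennreal: "0 \<le> c \<Longrightarrow> ennreal c ennpowr s = ennreal (c powr s)"
  by (simp add: ennpowr_def)

lemma ennpowr_mono:
  assumes "a \<le> b" "0 \<le> s"
  shows "a ennpowr s \<le> b ennpowr s"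
proof (cases "b = \<infinity>")
  case False
  then obtain y where y: "b = ennreal y" "0 \<le> y"
    by (metis ennreal_cases infinity_ennreal_def)
  with assms(1) obtain x where x: "a = ennreal x" "0 \<le> x"
    by (metis ennreal_cases ennreal_neq_top neq_top_trans)
  have "x \<le> y" using assms(1) x y by simp
  then show ?thesis
    using x y assms(2) by (simp add: ennpowr_ennreal powr_mono2 ennreal_leI)
qed (simp add: ennpowr_def)

lemma emeasure_lborel_ball_powr:
  fixes x :: "'a::euclidean_space"
  assumes "0 < r"
  shows "emeasure lborel (ball x r) =
    ennreal (unit_ball_vol (real DIM('a)) * r powr real DIM('a))"
  using assms by (simp add: emeasure_ball powr_realpow)

lemma nn_average_ball_le:
  fixes x :: "'a::euclidean_space"
  assumes "0 < r" "\<And>y. y \<in> ball x r \<Longrightarrow> g y \<le> M"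
  shows "nn_average (ball x r) g \<le> M"
proof -
  have pos: "emeasure lborel (ball x r) > 0"
    using assms(1) by (simp add: emeasure_lborel_ball_powr)
  have "(\<integral>\<^sup>+y\<in>ball x r. g y \<partial>lborel) \<le> (\<integral>\<^sup>+y. M * indicator (ball x r) y \<partial>lborel)"
    by (intro nn_integral_mono) (auto simp: indicator_def assms(2))
  also have "\<dots> = emeasure lborel (ball x r) * M"
    by (simp add: nn_integral_cmult_indicator mult.commute)
  finally show ?thesis
    unfolding nn_average_def by (intro divide_le_posI_ennreal pos)
qed

section \<open>The power weight is an Ap weight\<close>

text \<open>Dyadic decomposition of the ball: on the shell \<open>R/2^(j+1) \<le> norm y < R/2^j\<close> the integrand is
  at most its value on the inner sphere, and the resulting series is geometric with ratio
  \<open>2 powr (b - d) < 1\<close>, where \<open>d\<close> is the dimension.\<close>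

lemma nn_integral_norm_powr_ball_le:
  assumes "0 \<le> b" "b < real DIM('a::euclidean_space)"
  obtains C where "0 \<le> C" "\<And>R. 0 < R \<Longrightarrow>
    (\<integral>\<^sup>+y\<in>ball (0::'a) R. ennreal (norm y powr (- b)) \<partial>lborel) \<le> ennreal (C * R powr (real DIM('a) - b))"
proof
  define d where "d = real DIM('a)"
  define V where "V = unit_ball_vol d"
  define q where "q = 2 powr (b - d)"
  have V: "0 < V" unfolding V_def d_def by simp
  have q: "0 < q" "q < 1"
    using assms(2) powr_less_mono[of "b - d" 0 2] unfolding q_def d_def by auto
  show "0 \<le> V * 2 powr b / (1 - q)" using V q by simp
  fix R :: real assume R: "0 < R"
  define T where "T j = R / 2 ^ j" for j :: nat
  have T: "0 < T j" for j using R by (simp add: T_def)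
  define g :: "nat \<Rightarrow> 'a \<Rightarrow> ennreal"
    where "g j = (\<lambda>y. ennreal (T (Suc j) powr (- b)) * indicator (ball 0 (T j)) y)" for j
  have point: "ennreal (norm y powr (- b)) * indicator (ball 0 R) y \<le> (\<Sum>j. g j y)" for y
  proof (cases "y \<in> ball 0 R \<and> y \<noteq> 0")
    case True
    then have y: "norm y < R" "0 < norm y" by auto
    have "\<exists>j. T (Suc j) \<le> norm y"
    proof -
      obtain n where "(1/2::real) ^ n < norm y / R"
        using real_arch_pow_inv[of "norm y / R" "1/2"] y R by auto
      then have "T n < norm y" using R by (simp add: T_def field_simps)
      moreover have "T (Suc n) \<le> T n" using R by (simp add: T_def field_simps)
      ultimately show ?thesis by (meson less_eq_real_def order_trans)
    qed
    define j where "j = (LEAST j. T (Suc j) \<le> norm y)"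
    have j: "T (Suc j) \<le> norm y"
      unfolding j_def using \<open>\<exists>j. T (Suc j) \<le> norm y\<close> by (rule LeastI_ex)
    have "norm y < T j"
    proof (cases j)
      case 0
      then show ?thesis using y by (simp add: T_def)
    next
      case (Suc i)
      then have "\<not> T (Suc i) \<le> norm y"
        unfolding j_def by (metis lessI not_less_Least)
      then show ?thesis using Suc by simp
    qed
    moreover have "norm y powr (- b) \<le> T (Suc j) powr (- b)"
      using j T assms(1) by (intro powr_mono2') auto
    ultimately have "ennreal (norm y powr (- b)) * indicator (ball 0 R) y \<le> g j y"
      using True by (simp add: g_def ennreal_leI)
    also have "\<dots> = (\<Sum>i\<in>{j}. g i y)" by simp
    also have "\<dots> \<le> (\<Sum>j. g j y)" by (intro sum_le_suminf) auto
    finally show ?thesis .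
  qed (auto simp: indicator_def)
  have shell: "(\<integral>\<^sup>+y. g j y \<partial>lborel) = ennreal (V * 2 powr b * R powr (d - b) * q ^ j)" for j
  proof -
    have "(\<integral>\<^sup>+y. g j y \<partial>lborel) = ennreal (T (Suc j) powr (- b) * (V * T j powr d))"
      unfolding g_def using T[of j] V
      by (simp add: nn_integral_cmult_indicator emeasure_lborel_ball_powr V_def d_def ennreal_mult)
    also have "T (Suc j) powr (- b) * (V * T j powr d) = V * 2 powr b * R powr (d - b) * q ^ j"
    proof -
      have 1: "T (Suc j) = T j / 2" by (simp add: T_def)
      have "T (Suc j) powr (- b) = T j powr (- b) * 2 powr b"
        unfolding 1 using T[of j] by (simp add: powr_divide powr_minus field_simps)
      moreover have "T j powr (- b) * T j powr d = T j powr (d - b)"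
        by (simp add: powr_add[symmetric])
      moreover have "T j powr (d - b) = R powr (d - b) * q ^ j"
      proof -
        have "q ^ j = (2 ^ j) powr (b - d)"
          unfolding q_def by (simp add: powr_powr powr_realpow[symmetric] mult.commute)
        then show ?thesis
          using R by (simp add: T_def powr_divide powr_diff field_simps)
      qed
      ultimately show ?thesis by (simp add: mult_ac)
    qed
    finally show ?thesis .
  qed
  have "(\<integral>\<^sup>+y\<in>ball (0::'a) R. ennreal (norm y powr (- b)) \<partial>lborel) \<le> (\<integral>\<^sup>+y. (\<Sum>j. g j y) \<partial>lborel)"
    by (intro nn_integral_mono point)
  also have "\<dots> = (\<Sum>j. \<integral>\<^sup>+y. g j y \<partial>lborel)"
    by (rule nn_integral_suminf)
      (unfold g_def, intro borel_measurable_times_ennreal borel_measurable_const borel_measurable_indicator, simp)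
  also have "\<dots> = ennreal (V * 2 powr b * R powr (d - b) * (1 / (1 - q)))"
    unfolding shell using V q by (intro suminf_ennreal_eq sums_mult geometric_sums) auto
  also have "V * 2 powr b * R powr (d - b) * (1 / (1 - q)) = V * 2 powr b / (1 - q) * R powr (real DIM('a) - b)"
    by (simp add: d_def)
  finally show "(\<integral>\<^sup>+y\<in>ball (0::'a) R. ennreal (norm y powr (- b)) \<partial>lborel)
      \<le> ennreal (V * 2 powr b / (1 - q) * R powr (real DIM('a) - b))" .
qed

text \<open>Away from the origin (\<open>norm x \<ge> 2 r\<close>) the weight varies by a bounded factor over the ball.
  Near it (\<open>norm x < 2 r\<close>) the ball lies in \<open>ball 0 (3 r)\<close>, where the weight is bounded and the
  integral of its dual is controlled by the local integrability of \<open>norm y powr (- b)\<close>,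
  \<open>b = \<alpha> / (p - 1) < DIM('a)\<close>.  The powers of \<open>r\<close> cancel.\<close>

lemma Ap_weight_norm_powr:
  fixes p \<alpha> :: real
  assumes "1 < p" "0 \<le> \<alpha>" "\<alpha> < (p - 1) * real DIM('a::euclidean_space)"
  shows "Ap_weight p (\<lambda>x::'a. norm x powr \<alpha>)"
proof -
  define d where "d = real DIM('a)"
  define V where "V = unit_ball_vol d"
  define b where "b = \<alpha> / (p - 1)"
  have V: "0 < V" unfolding V_def d_def by simp
  have b: "0 \<le> b" "b < real DIM('a)" "b * (p - 1) = \<alpha>"
    using assms unfolding b_def by (auto simp: field_simps)
  obtain C where C: "0 \<le> C" "\<And>R. 0 < R \<Longrightarrow>
    (\<integral>\<^sup>+y\<in>ball (0::'a) R. ennreal (norm y powr (- b)) \<partial>lborel) \<le> ennreal (C * R powr (d - b))"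
    using nn_integral_norm_powr_ball_le[OF b(1,2)] unfolding d_def by metis
  define D where "D = C * 3 powr (d - b) / V"
  have D: "0 \<le> D" using C(1) V by (simp add: D_def)
  define K where "K = 3 powr \<alpha> * (1 + D powr (p - 1))"
  define A where "A x r = nn_average (ball x r) (\<lambda>y. ennreal (norm y powr \<alpha>))" for x :: 'a and r
  define B where "B x r = nn_average (ball x r) (\<lambda>y. ennreal ((norm y powr \<alpha>) powr (- 1 / (p - 1))))"
    for x :: 'a and r
  have dual: "(norm y powr \<alpha>) powr (- 1 / (p - 1)) = norm y powr (- b)" for y :: 'a
    by (simp add: powr_powr b_def)
  have prod: "A x r * B x r ennpowr (p - 1) \<le> ennreal (u * v powr (p - 1))"
    if "A x r \<le> ennreal u" "B x r \<le> ennreal v" "0 \<le> u" "0 \<le> v" for x r u v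
  proof -
    have "B x r ennpowr (p - 1) \<le> ennreal (v powr (p - 1))"
      using ennpowr_mono[OF that(2), of "p - 1"] that(4) assms(1) by (simp add: ennpowr_ennreal)
    then have "A x r * B x r ennpowr (p - 1) \<le> ennreal u * ennreal (v powr (p - 1))"
      using that(1) by (intro mult_mono) auto
    then show ?thesis using that(3) by (simp add: ennreal_mult)
  qed
  have bound: "A x r * B x r ennpowr (p - 1) \<le> ennreal K" if r: "0 < r" for x r
  proof (cases "2 * r \<le> norm x")
    case True
    have annulus: "norm x / 2 \<le> norm y" "norm y \<le> 3 * (norm x / 2)" if "y \<in> ball x r" for y
      using that True norm_triangle_ineq2[of x y] norm_triangle_ineq2[of y x]
      by (auto simp: dist_norm norm_minus_commute)
    have x: "0 < norm x / 2" using True r by auto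
    have "A x r \<le> ennreal ((3 * (norm x / 2)) powr \<alpha>)"
      unfolding A_def using r assms(2) annulus
      by (intro nn_average_ball_le ennreal_leI powr_mono2) auto
    moreover have "B x r \<le> ennreal ((norm x / 2) powr (- b))"
      unfolding B_def dual using r x b(1) annulus
      by (intro nn_average_ball_le ennreal_leI powr_mono2') auto
    ultimately have "A x r * B x r ennpowr (p - 1)
        \<le> ennreal ((3 * (norm x / 2)) powr \<alpha> * ((norm x / 2) powr (- b)) powr (p - 1))"
      by (intro prod) auto
    also have "(3 * (norm x / 2)) powr \<alpha> * ((norm x / 2) powr (- b)) powr (p - 1) = 3 powr \<alpha>"
    proof -
      have "((norm x / 2) powr (- b)) powr (p - 1) = (norm x / 2) powr (- \<alpha>)"
        using b(3) by (simp add: powr_powr)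
      moreover have "(3 * (norm x / 2)) powr \<alpha> = 3 powr \<alpha> * (norm x / 2) powr \<alpha>"
        by (subst powr_mult) auto
      moreover have "(norm x / 2) powr \<alpha> * (norm x / 2) powr (- \<alpha>) = 1"
        using x by (simp add: powr_add[symmetric])
      ultimately show ?thesis by simp
    qed
    also have "ennreal (3 powr \<alpha>) \<le> ennreal K"
      unfolding K_def by (intro ennreal_leI) (simp add: algebra_simps)
    finally show ?thesis .
  next
    case False
    have sub: "ball x r \<subseteq> ball 0 (3 * r)"
    proof
      fix y assume "y \<in> ball x r"
      then show "y \<in> ball 0 (3 * r)"
        using False norm_triangle_ineq2[of y x] by (auto simp: dist_norm norm_minus_commute)
    qed
    have "A x r \<le> ennreal ((3 * r) powr \<alpha>)"
      unfolding A_def using r assms(2) sub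
      by (intro nn_average_ball_le ennreal_leI powr_mono2) (auto simp: subset_iff intro: less_imp_le)
    moreover have "B x r \<le> ennreal (D * r powr (- b))"
    proof -
      have "(\<integral>\<^sup>+y\<in>ball x r. ennreal (norm y powr (- b)) \<partial>lborel)
          \<le> (\<integral>\<^sup>+y\<in>ball (0::'a) (3 * r). ennreal (norm y powr (- b)) \<partial>lborel)"
        using sub by (intro nn_integral_mono) (auto simp: indicator_def)
      also have "\<dots> \<le> ennreal (C * (3 * r) powr (d - b))" using C(2)[of "3 * r"] r by simp
      also have "C * (3 * r) powr (d - b) = (V * r powr d) * (D * r powr (- b))"
      proof -
        have "(3 * r) powr (d - b) = 3 powr (d - b) * r powr (d - b)"
          using r by (subst powr_mult) auto
        moreover have "r powr d * r powr (- b) = r powr (d - b)"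
          by (simp add: powr_add[symmetric])
        ultimately show ?thesis using V by (simp add: D_def)
      qed
      also have "ennreal \<dots> = emeasure lborel (ball x r) * ennreal (D * r powr (- b))"
        using V D r by (simp add: emeasure_lborel_ball_powr ennreal_mult V_def d_def)
      finally show ?thesis
        unfolding B_def nn_average_def dual
        using r by (intro divide_le_posI_ennreal) (auto simp: emeasure_lborel_ball_powr)
    qed
    ultimately have "A x r * B x r ennpowr (p - 1)
        \<le> ennreal ((3 * r) powr \<alpha> * (D * r powr (- b)) powr (p - 1))"
      using D by (intro prod) auto
    also have "(3 * r) powr \<alpha> * (D * r powr (- b)) powr (p - 1) = 3 powr \<alpha> * D powr (p - 1)"
    proof -
      have "(D * r powr (- b)) powr (p - 1) = D powr (p - 1) * r powr (- \<alpha>)"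
        using b(3) D by (simp add: powr_mult powr_powr)
      moreover have "(3 * r) powr \<alpha> = 3 powr \<alpha> * r powr \<alpha>"
        using r by (simp add: powr_mult)
      moreover have "r powr \<alpha> * r powr (- \<alpha>) = 1"
        using r by (simp add: powr_add[symmetric])
      ultimately show ?thesis by simp
    qed
    also have "ennreal (3 powr \<alpha> * D powr (p - 1)) \<le> ennreal K"
      unfolding K_def by (intro ennreal_leI) (simp add: algebra_simps)
    finally show ?thesis .
  qed
  have "(SUP (x, r)\<in>UNIV \<times> {0<..}. A x r * B x r ennpowr (p - 1)) \<le> ennreal K"
  proof (rule SUP_least)
    fix z :: "'a \<times> real" assume "z \<in> UNIV \<times> {0<..}"
    then have "0 < snd z" by (auto simp: mem_Times_iff)
    from bound[OF this, of "fst z"]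
    show "(case z of (x, r) \<Rightarrow> A x r * B x r ennpowr (p - 1)) \<le> ennreal K"
      by (simp only: case_prod_beta)
  qed
  also have "\<dots> < \<infinity>" by simp
  finally have sup: "(SUP (x, r)\<in>UNIV \<times> {0<..}. A x r * B x r ennpowr (p - 1)) < \<infinity>" .
  have pos: "AE x in lborel. 0 < norm (x::'a) powr \<alpha>"
    using AE_lborel_singleton[of "0::'a"] by eventually_elim simp
  have meas: "(\<lambda>x::'a. norm x powr \<alpha>) \<in> borel_measurable borel"
    by measurable
  show ?thesis
    unfolding Ap_weight_def using meas pos sup[unfolded A_def B_def] by (rule conjI[OF _ conjI])
qed

section \<open>A test function seen from a whole ball of centres\<close>

lemma bump_Lipschitz:
  "\<bar>max 0 (r - dist y c) - max 0 (r - dist y' c)\<bar> \<le> dist y y'"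
proof -
  have "\<bar>max 0 (r - u) - max 0 (r - v)\<bar> \<le> w" if "u \<le> w + v" "v \<le> w + u" "0 \<le> w" for u v w :: real
    using that by linarith
  moreover have "dist y c \<le> dist y y' + dist y' c" "dist y' c \<le> dist y y' + dist y c"
    by (metis dist_triangle, metis dist_triangle dist_commute)
  ultimately show ?thesis by simp
qed

lemma bump_integrable:
  "integrable lborel (\<lambda>z::'a::euclidean_space. max 0 (r - dist z c))"
proof -
  have "integrable lborel (\<lambda>z. indicator (cball c r) z *\<^sub>R max 0 (r - dist z c))"
    by (intro borel_integrable_compact continuous_intros) simp
  moreover have "(\<lambda>z. indicator (cball c r) z *\<^sub>R max 0 (r - dist z c)) = (\<lambda>z. max 0 (r - dist z c))"
    by (auto simp: indicator_def dist_commute fun_eq_iff)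
  ultimately show ?thesis by simp
qed

lemma bump_integral_translate:
  fixes c :: "'a::euclidean_space"
  shows "(\<integral>z. max 0 (r - dist z c) \<partial>lborel) = (\<integral>z. max 0 (r - norm (z::'a)) \<partial>lborel)"
proof -
  have "(\<integral>z. max 0 (r - dist z c) \<partial>lborel) = (\<integral>z. max 0 (r - dist z c) \<partial>distr lborel borel ((+) c))"
    by (simp add: lborel_distr_plus)
  also have "\<dots> = (\<integral>z. max 0 (r - dist (c + z) c) \<partial>lborel)"
    by (intro integral_distr) auto
  finally show ?thesis by (simp add: dist_norm)
qed

text \<open>A difference of two equal bumps has mean zero, and its support lies in \<open>cball 0 (1/4)\<close>, hence
  in the unit ball around every \<open>y\<close> with \<open>norm y < 1/2\<close>.  The size constraints do not involve the
  centre, so a single multiple \<open>\<phi>\<close> of it belongs to all these classes at scale \<open>k = 0\<close>.  The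
  function paired with it is the indicator of a ball where only the positive bump lives.\<close>

lemma maximal_coeff_indicator_ge:
  fixes a :: "'a::euclidean_space"
  assumes "0 < \<Phi>" "norm a = 1/8"
  obtains c where "0 < c" "\<And>y. norm y < 1/2 \<Longrightarrow>
    ennreal c \<le> maximal_coeff \<kappa> \<Phi> (\<lambda>t. t) (indicator (ball a (1/16))) y 0"
proof
  define V where "V = measure lborel (ball (0::'a) 1)"
  have V: "0 < V" unfolding V_def by simp
  have Vy: "measure lborel (ball y 1) = V" for y :: 'a
    unfolding V_def by (simp add: content_ball)
  define \<epsilon> where "\<epsilon> = min \<Phi> (1/2) / V"
  have e: "0 < \<epsilon>" "\<epsilon> \<le> \<Phi> / V" "2 * \<epsilon> \<le> 1 / V"
    using assms(1) V by (auto simp: \<epsilon>_def field_simps)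
  define bump where "bump c z = max 0 (1/8 - dist z c)" for c z :: 'a
  define \<phi> where "\<phi> z = \<epsilon> * (bump a z - bump (- a) z)" for z
  have int: "integrable lborel (bump c)" for c
    unfolding bump_def by (rule bump_integrable)
  have supp: "norm z \<le> 1/4" if "\<phi> z \<noteq> 0" for z
  proof (rule ccontr)
    assume "\<not> norm z \<le> 1/4"
    then have "bump a z = 0" "bump (- a) z = 0"
      using norm_triangle_ineq2[of z a] norm_triangle_ineq2[of z "- a"] assms(2)
      by (auto simp: bump_def dist_norm)
    then show False using that by (simp add: \<phi>_def)
  qed
  have in_class: "\<phi> \<in> test_class \<kappa> \<Phi> (\<lambda>t. t) y 0" if y: "norm y < 1/2" for y
  proof -
    have "closure {z. \<phi> z \<noteq> 0} \<subseteq> cball 0 (1/4)"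
      using supp by (intro closure_minimal) auto
    also have "\<dots> \<subseteq> ball y 1"
    proof
      fix z assume "z \<in> cball (0::'a) (1/4)"
      then show "z \<in> ball y 1"
        using y norm_triangle_ineq4[of y z] by (auto simp: dist_norm)
    qed
    finally have "closure {z. \<phi> z \<noteq> 0} \<subseteq> ball y 1" .
    moreover have "has_bochner_integral lborel \<phi> 0"
    proof -
      have "(\<integral>z. bump a z \<partial>lborel) = (\<integral>z. bump (- a) z \<partial>lborel)"
        unfolding bump_def by (simp only: bump_integral_translate)
      then show ?thesis
        unfolding has_bochner_integral_iff \<phi>_def using int by simp
    qed
    moreover have "\<bar>\<phi> z\<bar> \<le> \<Phi> / V" for z
    proof -
      have "0 \<le> bump c z" "bump c z \<le> 1/8" for c
        using zero_le_dist[of z c] unfolding bump_def by linarith+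
      from this[of a] this[of "- a"] have "\<bar>bump a z - bump (- a) z\<bar> \<le> 1" by linarith
      then have "\<bar>\<phi> z\<bar> \<le> \<epsilon> * 1"
        unfolding \<phi>_def abs_mult using e(1) by (intro mult_mono) auto
      then show ?thesis using e(2) by simp
    qed
    moreover have "\<bar>\<phi> z - \<phi> z'\<bar> \<le> dist z z' / V" for z z'
    proof -
      have "\<bar>bump c z - bump c z'\<bar> \<le> dist z z'" for c
        unfolding bump_def by (rule bump_Lipschitz)
      from this[of a] this[of "- a"]
      have "\<bar>(bump a z - bump (- a) z) - (bump a z' - bump (- a) z')\<bar> \<le> 2 * dist z z'" by linarith
      then have "\<epsilon> * \<bar>(bump a z - bump (- a) z) - (bump a z' - bump (- a) z')\<bar> \<le> \<epsilon> * (2 * dist z z')"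
        using e(1) by (intro mult_left_mono) auto
      moreover have "\<bar>\<phi> z - \<phi> z'\<bar> = \<epsilon> * \<bar>(bump a z - bump (- a) z) - (bump a z' - bump (- a) z')\<bar>"
        unfolding \<phi>_def right_diff_distrib[symmetric] abs_mult using e(1) by simp
      moreover have "(2 * \<epsilon>) * dist z z' \<le> 1 / V * dist z z'"
        using e(3) by (intro mult_right_mono) auto
      ultimately show ?thesis by simp
    qed
    ultimately show ?thesis
      unfolding test_class_def by (simp add: Vy)
  qed
  define m where "m = measure lborel (ball a (1/16))"
  have m: "0 < m" unfolding m_def by simp
  have lower: "\<epsilon> / 16 * indicator (ball a (1/16)) z \<le> indicator (ball a (1/16)) z * \<phi> z" for z
  proof (cases "z \<in> ball a (1/16)")
    case True
    then have za: "dist z a < 1/16" by (simp add: dist_commute)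
    have "norm (2 *\<^sub>R a) \<le> norm (z + a) + norm (z - a)"
      using norm_triangle_ineq4[of "z + a" "z - a"] by (simp add: scaleR_2)
    then have "bump (- a) z = 0"
      using za assms(2) by (simp add: bump_def dist_norm)
    moreover have "1/16 \<le> bump a z" using za by (simp add: bump_def)
    ultimately have "\<epsilon> * (1/16) \<le> \<phi> z"
      unfolding \<phi>_def using e(1) by (intro mult_left_mono) auto
    then show ?thesis using True by simp
  qed simp
  have \<phi>_int: "integrable lborel \<phi>"
    unfolding \<phi>_def using int by simp
  have ind: "integrable lborel (indicator (ball a (1/16)) :: 'a \<Rightarrow> real)"
    using emeasure_lborel_ball_finite by (simp add: integrable_indicator_iff)
  have "(\<integral>z. \<epsilon> / 16 * indicator (ball a (1/16)) z \<partial>lborel)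
      \<le> (\<integral>z. indicator (ball a (1/16)) z * \<phi> z \<partial>lborel)"
    using integrable_mult_indicator[OF _ \<phi>_int, of "ball a (1/16)"]
    by (intro integral_mono lower integrable_mult_right ind) simp_all
  then have pairing: "\<epsilon> / 16 * m \<le> (\<integral>z. indicator (ball a (1/16)) z * \<phi> z \<partial>lborel)"
    by (simp add: m_def)
  show "0 < \<epsilon> / 16 * m" using e(1) m by simp
  fix y :: 'a assume "norm y < 1/2"
  then have "ennreal \<bar>\<integral>z. indicator (ball a (1/16)) z * \<phi> z \<partial>lborel\<bar>
      \<le> maximal_coeff \<kappa> \<Phi> (\<lambda>t. t) (indicator (ball a (1/16))) y 0"
    unfolding maximal_coeff_def by (intro SUP_upper in_class)
  moreover have "ennreal (\<epsilon> / 16 * m) \<le> ennreal \<bar>\<integral>z. indicator (ball a (1/16)) z * \<phi> z \<partial>lborel\<bar>"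
    using pairing by (intro ennreal_leI) linarith
  ultimately show "ennreal (\<epsilon> / 16 * m)
      \<le> maximal_coeff \<kappa> \<Phi> (\<lambda>t. t) (indicator (ball a (1/16))) y 0" by (rule order_trans[rotated])
qed

section \<open>Growth of the weak type norm in the aperture\<close>

text \<open>Only the term \<open>k = 0\<close> is kept.  For \<open>norm x < \<beta>/2\<close> the averaging ball contains
  \<open>ball 0 (1/2)\<close>, on which the coefficients are bounded below, and averaging over a ball of volume
  comparable to \<open>\<beta>^d\<close> costs \<open>\<beta> powr (- d/2)\<close> after the square root.\<close>

lemma intrinsic_square_ge:
  fixes x :: "'a::euclidean_space"
  assumes "0 \<le> c" "\<And>y. norm y < 1/2 \<Longrightarrow> ennreal c \<le> maximal_coeff \<kappa> \<Phi> \<omega> f (y::'a) 0"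
    and "1 \<le> \<beta>" "norm x < \<beta> / 2"
  shows "ennreal (c * (1/2) powr (DIM('a) / 2) * \<beta> powr (- (DIM('a) / 2)))
    \<le> intrinsic_square \<kappa> \<Phi> \<omega> \<beta> f x"
proof -
  define d where "d = real DIM('a)"
  define V where "V = unit_ball_vol d"
  have V: "0 < V" unfolding V_def d_def by simp
  define F where "F k = nn_average (ball x (\<beta> * \<kappa> powi k)) (\<lambda>y. (maximal_coeff \<kappa> \<Phi> \<omega> f y k)\<^sup>2)" for k
  have sub: "ball 0 (1/2) \<subseteq> ball x \<beta>"
  proof
    fix y assume "y \<in> ball (0::'a) (1/2)"
    then show "y \<in> ball x \<beta>"
      using norm_triangle_ineq4[of x y] assms(3,4) by (auto simp: dist_norm)
  qed
  have "ennreal (c\<^sup>2 * (V * (1/2) powr d)) = (\<integral>\<^sup>+y. ennreal (c\<^sup>2) * indicator (ball (0::'a) (1/2)) y \<partial>lborel)"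
    using V by (simp add: nn_integral_cmult_indicator emeasure_lborel_ball_powr V_def d_def ennreal_mult)
  also have "\<dots> \<le> (\<integral>\<^sup>+y\<in>ball x \<beta>. (maximal_coeff \<kappa> \<Phi> \<omega> f y 0)\<^sup>2 \<partial>lborel)"
  proof (intro nn_integral_mono)
    fix y :: 'a
    show "ennreal (c\<^sup>2) * indicator (ball 0 (1/2)) y
        \<le> (maximal_coeff \<kappa> \<Phi> \<omega> f y 0)\<^sup>2 * indicator (ball x \<beta>) y"
    proof (cases "y \<in> ball 0 (1/2)")
      case True
      then have "(ennreal c)\<^sup>2 \<le> (maximal_coeff \<kappa> \<Phi> \<omega> f y 0)\<^sup>2"
        by (intro power_mono assms(2)) auto
      then show ?thesis using True sub assms(1) by (auto simp: ennreal_power)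
    qed simp
  qed
  finally have "ennreal (c\<^sup>2 * (V * (1/2) powr d)) / emeasure lborel (ball x \<beta>) \<le> F 0"
    unfolding F_def nn_average_def by (simp add: divide_right_mono_ennreal)
  moreover have "ennreal (c\<^sup>2 * (V * (1/2) powr d)) / emeasure lborel (ball x \<beta>)
      = ennreal (c\<^sup>2 * (1/2) powr d * \<beta> powr (- d))"
    using assms(3) V
    by (simp add: emeasure_lborel_ball_powr V_def[symmetric] d_def[symmetric] divide_ennreal powr_minus field_simps)
  moreover have "F 0 \<le> (\<Sum>\<^sub>\<infinity>k\<in>UNIV. F k)"
  proof -
    have "(\<Sum>\<^sub>\<infinity>k\<in>{0}. F k) \<le> (\<Sum>\<^sub>\<infinity>k\<in>UNIV. F k)"
      by (intro infsum_mono_neutral nonneg_summable_on_complete) auto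
    then show ?thesis by simp
  qed
  ultimately have "ennreal (c\<^sup>2 * (1/2) powr d * \<beta> powr (- d)) \<le> (\<Sum>\<^sub>\<infinity>k\<in>UNIV. F k)" by simp
  then have "ennreal (c\<^sup>2 * (1/2) powr d * \<beta> powr (- d)) ennpowr (1/2) \<le> intrinsic_square \<kappa> \<Phi> \<omega> \<beta> f x"
    unfolding intrinsic_square_def F_def by (intro ennpowr_mono) auto
  moreover have "(c\<^sup>2 * (1/2) powr d * \<beta> powr (- d)) powr (1/2)
      = c * (1/2) powr (d / 2) * \<beta> powr (- (d / 2))"
    using assms(1) by (simp add: powr_mult powr_powr powr_half_sqrt)
  ultimately show ?thesis
    by (simp add: ennpowr_ennreal d_def)
qed

lemma weight_measure_mono:
  "E \<subseteq> F \<Longrightarrow> weight_measure w E \<le> weight_measure w F"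
  unfolding weight_measure_def by (intro nn_integral_mono) (auto simp: indicator_def)

text \<open>Off the origin, the ball of radius \<open>R/4\<close> centred at distance \<open>3R/4\<close> already carries a fixed
  proportion of the mass.\<close>

lemma weight_measure_norm_powr_ball_ge:
  assumes "0 \<le> \<alpha>"
  obtains c where "0 < c" "\<And>R. 0 < R \<Longrightarrow>
    ennreal (c * R powr (real DIM('a) + \<alpha>)) \<le> weight_measure (\<lambda>x::'a::euclidean_space. norm x powr \<alpha>) (ball 0 R)"
proof
  define d where "d = real DIM('a)"
  define V where "V = unit_ball_vol d"
  have V: "0 < V" unfolding V_def d_def by simp
  define c where "c = V * (1/2) powr \<alpha> * (1/4) powr d"
  show "0 < V * (1/2) powr \<alpha> * (1/4) powr d" using V by simp
  fix R :: real assume R: "0 < R"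
  obtain e :: 'a where e: "norm e = 3/4 * R"
    using vector_choose_size[of "3/4 * R"] R by auto
  have annulus: "norm y < R" "R / 2 \<le> norm y" if "y \<in> ball e (R / 4)" for y
    using that e norm_triangle_ineq2[of y e] norm_triangle_ineq2[of e y]
    by (auto simp: dist_norm norm_minus_commute)
  have "c * R powr (d + \<alpha>) = (R / 2) powr \<alpha> * (V * (R / 4) powr d)"
    using R by (simp add: c_def powr_add powr_divide)
  then have "ennreal (c * R powr (d + \<alpha>))
      = (\<integral>\<^sup>+y. ennreal ((R / 2) powr \<alpha>) * indicator (ball e (R / 4)) y \<partial>lborel)"
    using R V by (simp add: nn_integral_cmult_indicator emeasure_lborel_ball_powr V_def d_def ennreal_mult)
  also have "\<dots> \<le> weight_measure (\<lambda>x::'a. norm x powr \<alpha>) (ball e (R / 4))"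
    unfolding weight_measure_def using R assms annulus
    by (intro nn_integral_mono) (auto simp: indicator_def intro!: ennreal_leI powr_mono2)
  also have "\<dots> \<le> weight_measure (\<lambda>x::'a. norm x powr \<alpha>) (ball 0 R)"
    using annulus by (intro weight_measure_mono) auto
  finally show "ennreal (V * (1/2) powr \<alpha> * (1/4) powr d * R powr (real DIM('a) + \<alpha>))
      \<le> weight_measure (\<lambda>x::'a. norm x powr \<alpha>) (ball 0 R)"
    by (simp add: c_def d_def)
qed

lemma indicator_ball_Lp_space:
  fixes a :: "'a::euclidean_space"
  assumes "1 < p" "0 \<le> \<alpha>" "norm a + r \<le> 1"
  shows "indicator (ball a r) \<in> Lp_space p (\<lambda>x. norm x powr \<alpha>)"
proof -
  have "norm x \<le> 1" if "x \<in> ball a r" for x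
    using that assms(3) norm_triangle_ineq2[of x a] by (auto simp: dist_norm norm_minus_commute)
  then have "(\<integral>\<^sup>+x. ennreal (\<bar>indicator (ball a r) x\<bar> powr p * norm x powr \<alpha>) \<partial>lborel)
      \<le> (\<integral>\<^sup>+x. indicator (ball a r) x \<partial>lborel)"
    using assms(2) by (intro nn_integral_mono) (auto simp: indicator_def intro!: powr_le1)
  also have "\<dots> < \<infinity>" using emeasure_lborel_ball_finite[of a r] by simp
  finally have "(\<integral>\<^sup>+x. ennreal (\<bar>indicator (ball a r) x\<bar> powr p * norm x powr \<alpha>) \<partial>lborel) < \<infinity>" .
  then have "Lp_norm p (\<lambda>x. norm x powr \<alpha>) (indicator (ball a r)) < \<infinity>"
    unfolding Lp_norm_def ennpowr_def by (auto simp: less_top)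
  moreover have "indicator (ball a r) \<in> borel_measurable (borel :: 'a measure)"
    by (intro borel_measurable_indicator) simp
  ultimately show ?thesis by (simp add: Lp_space_def)
qed

text \<open>The level set at height comparable to \<open>\<beta> powr (- d/2)\<close> contains \<open>ball 0 (\<beta>/2)\<close>, whose
  mass is comparable to \<open>\<beta> powr (d + \<alpha>)\<close>, while the function itself does not depend on \<open>\<beta>\<close>.\<close>

lemma weak_type_norm_ge:
  fixes \<kappa> \<Phi> p \<alpha> :: real
  assumes "0 < \<Phi>" "1 < p" "0 \<le> \<alpha>"
  obtains c where "0 < c" "\<And>\<beta>. 1 \<le> \<beta> \<Longrightarrow>
    ennreal (c * \<beta> powr ((real DIM('a) + \<alpha>) / p - real DIM('a) / 2))
      \<le> weak_type_norm p (\<lambda>x::'a::euclidean_space. norm x powr \<alpha>) (intrinsic_square \<kappa> \<Phi> (\<lambda>t. t) \<beta>)"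
proof -
  define d where "d = real DIM('a)"
  let ?w = "\<lambda>x::'a. norm x powr \<alpha>"
  obtain a :: 'a where a: "norm a = 1/8"
    using vector_choose_size[of "1/8"] by auto
  define f :: "'a \<Rightarrow> real" where "f = indicator (ball a (1/16))"
  obtain c1 where c1: "0 < c1"
    "\<And>y. norm y < 1/2 \<Longrightarrow> ennreal c1 \<le> maximal_coeff \<kappa> \<Phi> (\<lambda>t. t) f y 0"
    using maximal_coeff_indicator_ge[OF assms(1) a] unfolding f_def by metis
  obtain c2 where c2: "0 < c2"
    "\<And>R. 0 < R \<Longrightarrow> ennreal (c2 * R powr (d + \<alpha>)) \<le> weight_measure ?w (ball 0 R)"
    using weight_measure_norm_powr_ball_ge[OF assms(3)] unfolding d_def by metis
  have f: "f \<in> Lp_space p ?w"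
    unfolding f_def using assms a by (intro indicator_ball_Lp_space) auto
  then obtain l where l: "0 \<le> l" "Lp_norm p ?w f = ennreal l"
    unfolding Lp_space_def by (cases "Lp_norm p ?w f") auto
  define s where "s = c1 * (1/2) powr (d / 2) / 2"
  have s: "0 < s" using c1(1) by (simp add: s_def)
  define u where "u = (c2 * (1/2) powr (d + \<alpha>)) powr (1/p)"
  have u: "0 < u" using c2(1) by (simp add: u_def)
  have main: "ennreal (s * u / (l + 1) * \<beta> powr ((d + \<alpha>) / p - d / 2))
      \<le> weak_type_norm p ?w (intrinsic_square \<kappa> \<Phi> (\<lambda>t. t) \<beta>)" if \<beta>: "1 \<le> \<beta>" for \<beta>
  proof -
    let ?G = "intrinsic_square \<kappa> \<Phi> (\<lambda>t. t) \<beta> f"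
    \<comment> \<open>\<open>s\<close> is half of the constant in the lower bound, because the level set is defined by a
      strict inequality.\<close>
    define t where "t = s * \<beta> powr (- (d / 2))"
    have t: "0 < t" using s \<beta> by (simp add: t_def)
    have "ball 0 (\<beta> / 2) \<subseteq> {x. ?G x > ennreal t}"
    proof
      fix x assume "x \<in> ball (0::'a) (\<beta> / 2)"
      then have "ennreal (2 * t) \<le> ?G x"
        using intrinsic_square_ge[OF less_imp_le[OF c1(1)] c1(2) \<beta>, of x]
        by (simp add: t_def s_def d_def)
      moreover have "ennreal t < ennreal (2 * t)" using t by (simp add: ennreal_lessI)
      ultimately show "x \<in> {x. ?G x > ennreal t}" by (auto intro: less_le_trans)
    qed
    then have "ennreal (c2 * (\<beta> / 2) powr (d + \<alpha>)) \<le> weight_measure ?w {x. ?G x > ennreal t}"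
      using \<beta> by (intro order_trans[OF c2(2) weight_measure_mono]) auto
    then have "ennreal (c2 * (\<beta> / 2) powr (d + \<alpha>)) ennpowr (1/p)
        \<le> weight_measure ?w {x. ?G x > ennreal t} ennpowr (1/p)"
      using assms(2) by (intro ennpowr_mono) auto
    moreover have "(c2 * (\<beta> / 2) powr (d + \<alpha>)) powr (1/p) = u * \<beta> powr ((d + \<alpha>) / p)"
    proof -
      have "c2 * (\<beta> / 2) powr (d + \<alpha>) = (c2 * (1/2) powr (d + \<alpha>)) * \<beta> powr (d + \<alpha>)"
        using \<beta> by (simp add: powr_divide)
      also have "\<dots> powr (1/p) = u * \<beta> powr ((d + \<alpha>) / p)"
        using c2(1) by (subst powr_mult) (auto simp: u_def powr_powr)
      finally show ?thesis .
    qed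
    ultimately have "ennreal (u * \<beta> powr ((d + \<alpha>) / p))
        \<le> weight_measure ?w {x. ?G x > ennreal t} ennpowr (1/p)"
      using c2(1) by (simp add: ennpowr_ennreal)
    then have "ennreal t * ennreal (u * \<beta> powr ((d + \<alpha>) / p))
        \<le> ennreal t * weight_measure ?w {x. ?G x > ennreal t} ennpowr (1/p)"
      by (rule mult_left_mono) simp
    also have "\<dots> \<le> weak_Lp_norm p ?w ?G"
      unfolding weak_Lp_norm_def using t by (intro SUP_upper) auto
    finally have weak: "ennreal (t * (u * \<beta> powr ((d + \<alpha>) / p))) \<le> weak_Lp_norm p ?w ?G"
      using t u by (simp add: ennreal_mult)
    \<comment> \<open>Dividing by \<open>l + 1\<close> instead of \<open>l\<close> avoids showing that the norm of \<open>f\<close> is positive.\<close>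
    define h where "h = t * (u * \<beta> powr ((d + \<alpha>) / p))"
    have h: "0 \<le> h" using t u by (simp add: h_def)
    have "ennreal (h / (l + 1)) \<le> weak_type_norm p ?w (intrinsic_square \<kappa> \<Phi> (\<lambda>t. t) \<beta>)"
      unfolding weak_type_norm_def
    proof (rule Inf_greatest, clarify)
      fix N assume "\<forall>f\<in>Lp_space p ?w. weak_Lp_norm p ?w (intrinsic_square \<kappa> \<Phi> (\<lambda>t. t) \<beta> f) \<le> N * Lp_norm p ?w f"
      with f weak l have "ennreal h \<le> N * ennreal l"
        unfolding h_def by (metis order_trans)
      also have "\<dots> \<le> ennreal (l + 1) * N"
        by (subst mult.commute) (intro mult_right_mono ennreal_leI, auto)
      finally have "ennreal h / ennreal (l + 1) \<le> N"
        using l(1) by (intro divide_le_posI_ennreal) (simp_all del: ennreal_plus)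
      then show "ennreal (h / (l + 1)) \<le> N"
        using h l(1) by (simp add: divide_ennreal del: ennreal_plus)
    qed
    moreover have "h / (l + 1) = s * u / (l + 1) * \<beta> powr ((d + \<alpha>) / p - d / 2)"
      by (simp add: h_def t_def powr_add[symmetric] algebra_simps diff_divide_distrib)
    ultimately show ?thesis by simp
  qed
  show thesis
    by (rule that[of "s * u / (l + 1)"]) (use s u l main in \<open>auto simp: d_def\<close>)
qed

section \<open>Optimality of the exponent\<close>

theorem mainTheorem3:
  fixes \<kappa> \<Phi> p :: real
  assumes "\<kappa> > 1" and "\<Phi> > 0" and "p > 1"
  shows "\<forall>\<theta><1/2. \<exists>\<alpha>::real.
    - real CARD('n) < \<alpha> \<and> \<alpha> < (p - 1) * real CARD('n) \<and>
    (let w = (\<lambda>x :: real^'n. norm x powr \<alpha>) in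
      Ap_weight p w \<and>
      (SUP \<beta>\<in>{1..}. ennreal (\<beta> powr (- real CARD('n) * \<theta>)) *
         weak_type_norm p w (intrinsic_square \<kappa> \<Phi> (\<lambda>t. t) \<beta>)) = \<infinity>)"
proof (intro allI impI)
  fix \<theta> :: real assume \<theta>: "\<theta> < 1/2"
  define d where "d = real CARD('n)"
  have d: "0 < d" by (simp add: d_def)
  \<comment> \<open>\<open>q = (d + \<alpha>) / (d p)\<close> has to exceed \<open>\<theta> + 1/2\<close> for growth and be less than 1 for the Ap
    condition; \<open>q \<ge> 1/p\<close> makes \<open>\<alpha> \<ge> 0\<close>.\<close>
  obtain q where q: "max (\<theta> + 1/2) (1/p) < q" "q < 1"
    using dense[of "max (\<theta> + 1/2) (1/p)" 1] \<theta> assms(3) by auto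
  define \<alpha> where "\<alpha> = d * (p * q - 1)"
  have "1 < p * q" using q(1) assms(3) by (simp add: field_simps)
  then have \<alpha>0: "0 \<le> \<alpha>" using d by (simp add: \<alpha>_def)
  have "p * q - 1 < p - 1" using q(2) assms(3) by simp
  then have \<alpha>1: "\<alpha> < (p - 1) * d" using d by (simp add: \<alpha>_def mult.commute)
  let ?w = "\<lambda>x :: real^'n. norm x powr \<alpha>"
  have Ap: "Ap_weight p ?w"
    using Ap_weight_norm_powr[where 'a="real^'n", of p \<alpha>] assms(3) \<alpha>0 \<alpha>1 by (simp add: d_def)
  define \<delta> where "\<delta> = d * (q - 1/2 - \<theta>)"
  have \<delta>: "0 < \<delta>" using q(1) d by (simp add: \<delta>_def)
  obtain c where c: "0 < c" "\<And>\<beta>. 1 \<le> \<beta> \<Longrightarrow>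
    ennreal (c * \<beta> powr ((d + \<alpha>) / p - d / 2)) \<le> weak_type_norm p ?w (intrinsic_square \<kappa> \<Phi> (\<lambda>t. t) \<beta>)"
    using weak_type_norm_ge[where 'a="real^'n" and \<kappa>=\<kappa>, OF assms(2,3) \<alpha>0] by (auto simp: d_def)
  have growth: "ennreal (c * \<beta> powr \<delta>) \<le> ennreal (\<beta> powr (- d * \<theta>)) *
      weak_type_norm p ?w (intrinsic_square \<kappa> \<Phi> (\<lambda>t. t) \<beta>)" if "1 \<le> \<beta>" for \<beta>
  proof -
    have "(d + \<alpha>) / p - d / 2 = \<delta> + d * \<theta>"
      using assms(3) by (simp add: \<alpha>_def \<delta>_def field_simps)
    then have "\<beta> powr (- d * \<theta>) * (c * \<beta> powr ((d + \<alpha>) / p - d / 2)) = c * \<beta> powr \<delta>"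
      using that by (simp add: powr_add powr_minus)
    then have "ennreal (c * \<beta> powr \<delta>)
        = ennreal (\<beta> powr (- d * \<theta>)) * ennreal (c * \<beta> powr ((d + \<alpha>) / p - d / 2))"
      using c(1) by (simp add: ennreal_mult[symmetric])
    also have "\<dots> \<le> ennreal (\<beta> powr (- d * \<theta>)) *
        weak_type_norm p ?w (intrinsic_square \<kappa> \<Phi> (\<lambda>t. t) \<beta>)"
      by (intro mult_left_mono c(2) that) simp
    finally show ?thesis .
  qed
  have "(SUP \<beta>\<in>{1..}. ennreal (\<beta> powr (- d * \<theta>)) *
      weak_type_norm p ?w (intrinsic_square \<kappa> \<Phi> (\<lambda>t. t) \<beta>)) = \<infinity>"
    unfolding infinity_ennreal_def
  proof (rule ennreal_SUP_eq_top)
    fix n :: nat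
    define \<beta> where "\<beta> = max 1 ((real n / c) powr (1 / \<delta>))"
    have "real n / c = ((real n / c) powr (1 / \<delta>)) powr \<delta>"
      using \<delta> c(1) by (simp add: powr_powr)
    also have "\<dots> \<le> \<beta> powr \<delta>"
      using \<delta> by (intro powr_mono2) (auto simp: \<beta>_def)
    finally have "real n \<le> c * \<beta> powr \<delta>"
      using c(1) by (simp add: field_simps)
    then have "of_nat n \<le> ennreal (c * \<beta> powr \<delta>)"
      unfolding ennreal_of_nat_eq_real_of_nat by (rule ennreal_leI)
    also have "\<dots> \<le> ennreal (\<beta> powr (- d * \<theta>)) *
        weak_type_norm p ?w (intrinsic_square \<kappa> \<Phi> (\<lambda>t. t) \<beta>)"
      by (intro growth) (simp add: \<beta>_def)
    finally show "\<exists>\<beta>\<in>{1..}. of_nat n \<le> ennreal (\<beta> powr (- d * \<theta>)) *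
        weak_type_norm p ?w (intrinsic_square \<kappa> \<Phi> (\<lambda>t. t) \<beta>)"
      by (intro bexI[of _ \<beta>]) (auto simp: \<beta>_def)
  qed
  moreover have "- d < \<alpha>" using \<alpha>0 d by simp
  ultimately show "\<exists>\<alpha>::real.
    - real CARD('n) < \<alpha> \<and> \<alpha> < (p - 1) * real CARD('n) \<and>
    (let w = (\<lambda>x :: real^'n. norm x powr \<alpha>) in
      Ap_weight p w \<and>
      (SUP \<beta>\<in>{1..}. ennreal (\<beta> powr (- real CARD('n) * \<theta>)) *
         weak_type_norm p w (intrinsic_square \<kappa> \<Phi> (\<lambda>t. t) \<beta>)) = \<infinity>)"
    using Ap \<alpha>1 unfolding d_def Let_def by blast
qed

end
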